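(* Let $F$ be a field of characteristic different from $2$, let $Q_1,Q_2,Q_3,Q_4$ be quaternion $F$-algebras with canonical involutions $\gamma_i$, and let $(D,\gamma)=(Q_1,\gamma_1)\otimes(Q_2,\gamma_2)$. Let $u\in D$ be invertible with $\gamma(u)=u$ and $\mathrm{Trd}_D(u)=0$, and suppose there is an isomorphism of algebras with involution $(Q_3,\gamma_3)\otimes(Q_4,\gamma_4)\simeq(D,\mathrm{Int}(u^{-1})\circ\gamma)$. Then the $16$-dimensional quadratic space $(D,q_u)$, where $q_u(x)=\mathrm{Trd}_D(xu\gamma(x))$, contains a totally isotropic subspace of dimension $5$.
   Context: The canonical involution of a quaternion algebra $Q$ is $\gamma_Q(x)=\mathrm{Trd}_Q(x)-x$. $\mathrm{Trd}_D$ is the reduced trace of $D$; $\mathrm{Int}(a)(x)=axa^{-1}$. *)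

theory Defs
  imports "HOL-Analysis.Analysis"
begin

text \<open>Basis labels of a quaternion algebra (a,b)_F: 1, i, j, k = ij.\<close>
datatype qb = Q0 | QI | QJ | QK

lemma UNIV_qb: "(UNIV :: qb set) = {Q0, QI, QJ, QK}"
  by (auto intro: qb.exhaust)

instance qb :: finite
  by standard (simp add: UNIV_qb)

text \<open>Multiplication table of (a,b)_F: i^2 = a, j^2 = b, k = ij = -ji.
  qprod a b s t = (c, r) means e_s * e_t = c * e_r.\<close>
fun qprod :: "'a::field \<Rightarrow> 'a \<Rightarrow> qb \<Rightarrow> qb \<Rightarrow> 'a \<times> qb" where
  "qprod a b Q0 t = (1, t)"
| "qprod a b QI Q0 = (1, QI)"
| "qprod a b QI QI = (a, Q0)"
| "qprod a b QI QJ = (1, QK)"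
| "qprod a b QI QK = (a, QJ)"
| "qprod a b QJ Q0 = (1, QJ)"
| "qprod a b QJ QI = (-1, QK)"
| "qprod a b QJ QJ = (b, Q0)"
| "qprod a b QJ QK = (-b, QI)"
| "qprod a b QK Q0 = (1, QK)"
| "qprod a b QK QI = (-a, QJ)"
| "qprod a b QK QJ = (b, QI)"
| "qprod a b QK QK = (-(a*b), Q0)"

text \<open>Structure constant: coefficient of e_r in e_s * e_t.\<close>
definition qsc :: "'a::field \<Rightarrow> 'a \<Rightarrow> qb \<Rightarrow> qb \<Rightarrow> qb \<Rightarrow> 'a" where
  "qsc a b s t r = (if snd (qprod a b s t) = r then fst (qprod a b s t) else 0)"

text \<open>Elements of the biquaternion algebra (a,b)_F \<otimes> (c,d)_F are vectors in F^16,
  coordinates indexed by pairs of basis labels (e_s \<otimes> e_t).\<close>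
type_synonym 'a biquat = "'a ^ (qb \<times> qb)"

definition bq_mult :: "'a::field \<Rightarrow> 'a \<Rightarrow> 'a \<Rightarrow> 'a \<Rightarrow> 'a biquat \<Rightarrow> 'a biquat \<Rightarrow> 'a biquat" where
  "bq_mult a b c d x y = (\<chi> r. \<Sum>s\<in>UNIV. \<Sum>t\<in>UNIV.
      x $ s * y $ t * qsc a b (fst s) (fst t) (fst r) * qsc c d (snd s) (snd t) (snd r))"

definition bq_one :: "'a::field biquat" where
  "bq_one = (\<chi> r. if r = (Q0, Q0) then 1 else 0)"

text \<open>Canonical involution sign: gamma_Q(e_0) = e_0, gamma_Q(e_s) = - e_s otherwise.\<close>
definition qeps :: "qb \<Rightarrow> 'a::field" where
  "qeps s = (if s = Q0 then 1 else -1)"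

text \<open>gamma_1 \<otimes> gamma_2 (tensor product of canonical involutions).\<close>
definition bq_inv :: "'a::field biquat \<Rightarrow> 'a biquat" where
  "bq_inv x = (\<chi> p. qeps (fst p) * qeps (snd p) * x $ p)"

text \<open>Reduced trace of the degree-4 algebra: Trd(x \<otimes> y) = Trd(x) Trd(y), Trd_Q(e_0)=2.\<close>
definition bq_trd :: "'a::field biquat \<Rightarrow> 'a" where
  "bq_trd x = 4 * x $ (Q0, Q0)"

definition bq_invertible :: "'a::field \<Rightarrow> 'a \<Rightarrow> 'a \<Rightarrow> 'a \<Rightarrow> 'a biquat \<Rightarrow> bool" where
  "bq_invertible a b c d u \<longleftrightarrow> (\<exists>v. bq_mult a b c d u v = bq_one \<and> bq_mult a b c d v u = bq_one)"

definition bq_inverse :: "'a::field \<Rightarrow> 'a \<Rightarrow> 'a \<Rightarrow> 'a \<Rightarrow> 'a biquat \<Rightarrow> 'a biquat" where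
  "bq_inverse a b c d u = (THE v. bq_mult a b c d u v = bq_one \<and> bq_mult a b c d v u = bq_one)"

text \<open>The quadratic form q_u(x) = Trd_D(x u gamma(x)).\<close>
definition bq_qform :: "'a::field \<Rightarrow> 'a \<Rightarrow> 'a \<Rightarrow> 'a \<Rightarrow> 'a biquat \<Rightarrow> 'a biquat \<Rightarrow> 'a" where
  "bq_qform a b c d u x = bq_trd (bq_mult a b c d (bq_mult a b c d x u) (bq_inv x))"

text \<open>phi is an isomorphism of F-algebras with involution
  ((e,f)\<otimes>(g,h), gamma_3 \<otimes> gamma_4) \<cong> ((a,b)\<otimes>(c,d), tau).\<close>
definition bq_iso_inv ::
  "'a::field \<Rightarrow> 'a \<Rightarrow> 'a \<Rightarrow> 'a \<Rightarrow> 'a \<Rightarrow> 'a \<Rightarrow> 'a \<Rightarrow> 'a \<Rightarrow>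
   ('a biquat \<Rightarrow> 'a biquat) \<Rightarrow> ('a biquat \<Rightarrow> 'a biquat) \<Rightarrow> bool" where
  "bq_iso_inv e f g h a b c d tau phi \<longleftrightarrow>
     Vector_Spaces.linear (*s) (*s) phi \<and> bij phi \<and>
     phi bq_one = bq_one \<and>
     (\<forall>x y. phi (bq_mult e f g h x y) = bq_mult a b c d (phi x) (phi y)) \<and>
     (\<forall>x. phi (bq_inv x) = tau (phi x))"

end

theory Submission
  imports Defs
begin

(*
  Let alpha be the image of i (x) 1 under the given isomorphism. Then alpha^2 = e and
  tau(alpha) = -alpha, i.e. gamma(alpha) u = - u alpha. Being symmetric of trace zero, u lies in
  Q1^0 (x) Q2^0, so Trd(z u) = 0 whenever z lies in Q1 or in Q2. For B(x, y) = Trd(x u gamma(y))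
  this gives B(m gamma(alpha), n gamma(alpha)) = - e Trd(gamma(n) m u) = 0 for m, n in Q2, and
  B(x, x) = 0 for x in Q1. As u alpha is gamma-skew, every pure x in Q1 with Trd(x u alpha) = 0 is
  moreover orthogonal to Q2 gamma(alpha). These x form a space of dimension at least 2, whereas
  two pure quaternions of Q1 lying in Q2 gamma(alpha) are proportional, their product lying in Q2.
  So some such x is not in Q2 gamma(alpha), and x together with the 4-dimensional space
  Q2 gamma(alpha) spans a totally isotropic subspace of dimension 5.
*)

lemma sum_UNIV_qb: "(\<Sum>x\<in>UNIV. f x) = f Q0 + f QI + f QJ + f QK"
  by (simp add: UNIV_qb add.assoc)

lemma sum_UNIV_prod: "(\<Sum>x\<in>UNIV. f x) = (\<Sum>x1\<in>UNIV. \<Sum>x2\<in>UNIV. f (x1, x2))"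
  by (simp add: sum.cartesian_product)

lemma sum_sum_eq_single:
  fixes F :: "'b::finite \<Rightarrow> 'c::finite \<Rightarrow> 'a::comm_monoid_add"
  assumes "\<And>s t. (s, t) \<noteq> (i, j) \<Longrightarrow> F s t = 0"
  shows "(\<Sum>s\<in>UNIV. \<Sum>t\<in>UNIV. F s t) = F i j"
proof -
  have "(\<Sum>s\<in>UNIV. \<Sum>t\<in>UNIV. F s t) = (\<Sum>p\<in>UNIV. case_prod F p)"
    by (simp add: sum.cartesian_product)
  also have "\<dots> = (\<Sum>p\<in>{(i, j)}. case_prod F p)"
    by (rule sum.mono_neutral_right) (use assms in auto)
  finally show ?thesis by simp
qed

lemma sum_outer3_innermost:
  "(\<Sum>m\<in>A. \<Sum>s\<in>B. \<Sum>t\<in>C. F m s t) = (\<Sum>s\<in>B. \<Sum>t\<in>C. \<Sum>m\<in>A. F m s t)"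
proof -
  have "(\<Sum>m\<in>A. \<Sum>s\<in>B. \<Sum>t\<in>C. F m s t) = (\<Sum>s\<in>B. \<Sum>m\<in>A. \<Sum>t\<in>C. F m s t)"
    by (rule sum.swap)
  also have "\<dots> = (\<Sum>s\<in>B. \<Sum>t\<in>C. \<Sum>m\<in>A. F m s t)"
    by (intro sum.cong refl sum.swap)
  finally show ?thesis .
qed

lemma sum_outer4_innermost:
  "(\<Sum>m\<in>A. \<Sum>w\<in>B. \<Sum>s\<in>C. \<Sum>t\<in>D. F m w s t) =
   (\<Sum>s\<in>C. \<Sum>t\<in>D. \<Sum>w\<in>B. \<Sum>m\<in>A. F m w s t)"
proof -
  have "(\<Sum>m\<in>A. \<Sum>w\<in>B. \<Sum>s\<in>C. \<Sum>t\<in>D. F m w s t) =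
      (\<Sum>m\<in>A. \<Sum>s\<in>C. \<Sum>t\<in>D. \<Sum>w\<in>B. F m w s t)"
    by (rule sum.cong[OF refl], rule sum_outer3_innermost)
  also have "\<dots> = (\<Sum>s\<in>C. \<Sum>t\<in>D. \<Sum>m\<in>A. \<Sum>w\<in>B. F m w s t)"
    by (rule sum_outer3_innermost)
  also have "\<dots> = (\<Sum>s\<in>C. \<Sum>t\<in>D. \<Sum>w\<in>B. \<Sum>m\<in>A. F m w s t)"
    by (intro sum.cong refl sum.swap)
  finally show ?thesis .
qed

lemma eq_neg_imp_zero: "(2::'a::field) \<noteq> 0 \<Longrightarrow> x = - x \<Longrightarrow> x = (0::'a)"
  by (simp add: eq_neg_iff_add_eq_0 flip: mult_2)

lemma exists_nonparallel_solutions: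
  fixes w1 w2 w3 :: "'a::field"
  shows "\<exists>p q r p' q' r'. p * w1 + q * w2 + r * w3 = 0 \<and> p' * w1 + q' * w2 + r' * w3 = 0 \<and>
           \<not> (p * q' = q * p' \<and> p * r' = r * p' \<and> q * r' = r * q')"
proof (cases "w3 = 0")
  case False
  then show ?thesis
    by (intro exI[of _ 0] exI[of _ w3] exI[of _ "-w2"] exI[of _ "-w3"] exI[of _ 0] exI[of _ w1])
      (simp add: algebra_simps)
next
  case w3: True
  show ?thesis
  proof (cases "w2 = 0")
    case False
    with w3 show ?thesis
      by (intro exI[of _ 0] exI[of _ 0] exI[of _ 1] exI[of _ w2] exI[of _ "-w1"] exI[of _ 0])
        (simp add: algebra_simps)
  next
    case True
    with w3 show ?thesis
      by (intro exI[of _ 0] exI[of _ 1] exI[of _ 0] exI[of _ 0] exI[of _ 0] exI[of _ 1]) simp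
  qed
qed

lemma span_isotropic:
  fixes B :: "'a::field ^ 'n \<Rightarrow> 'a ^ 'n \<Rightarrow> 'a"
  assumes left: "\<And>y. vec.subspace {x. B x y = 0}" and right: "\<And>x. vec.subspace {y. B x y = 0}"
    and S: "\<And>x y. x \<in> S \<Longrightarrow> y \<in> S \<Longrightarrow> B x y = 0"
    and x: "x \<in> vec.span S" and y: "y \<in> vec.span S"
  shows "B x y = 0"
proof -
  have S_span: "B x' y = 0" if "x' \<in> S" for x'
    using y right[of x'] by (rule vec.span_induct) (simp add: S that)
  show ?thesis
    using x left[of y] by (rule vec.span_induct) (simp add: S_span)
qed

lemma qsc_assoc:
  "(\<Sum>m\<in>UNIV. qsc a b s t m * qsc a b m w r) = (\<Sum>m\<in>UNIV. qsc a b t w m * qsc a b s m r)"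
  by (cases s; cases t; cases w; cases r; simp add: qsc_def sum_UNIV_qb)

lemma qsc_anti_involution: "qeps r * qsc a b s t r = qeps s * qeps t * qsc a b t s r"
  by (cases s; cases t; cases r; simp add: qsc_def qeps_def)

lemma qsc_Q0_left: "qsc a b Q0 t r = (if t = r then 1 else 0)"
  by (simp add: qsc_def)

lemma qsc_Q0_right: "qsc a b s Q0 r = (if s = r then 1 else 0)"
  by (cases s; simp add: qsc_def)

(* e_s * e_s = qsq a b s *)
fun qsq :: "'a::field \<Rightarrow> 'a \<Rightarrow> qb \<Rightarrow> 'a" where
  "qsq a b Q0 = 1" | "qsq a b QI = a" | "qsq a b QJ = b" | "qsq a b QK = -(a*b)"

lemma qsc_coeff_one: "qsc a b s t Q0 = (if s = t then qsq a b s else 0)"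
  by (cases s; cases t; simp add: qsc_def)

definition bq_eps :: "qb \<times> qb \<Rightarrow> 'a::field" where
  "bq_eps p = qeps (fst p) * qeps (snd p)"

lemma bq_eps_square: "bq_eps p * bq_eps p = (1::'a::field)"
  by (cases "fst p"; cases "snd p"; simp add: bq_eps_def qeps_def)

lemma bq_inv_nth: "bq_inv x $ p = bq_eps p * x $ p"
  by (simp add: bq_inv_def bq_eps_def)

lemma bq_inv_inv [simp]: "bq_inv (bq_inv x) = (x::'a::field biquat)"
  by (simp add: vec_eq_iff bq_inv_nth mult.assoc[symmetric] bq_eps_square)

lemma bq_inv_add: "bq_inv (x + y) = bq_inv x + bq_inv y"
  by (simp add: vec_eq_iff bq_inv_nth algebra_simps)

lemma bq_inv_scale: "bq_inv (k *s x) = k *s bq_inv x"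
  by (simp add: vec_eq_iff bq_inv_nth algebra_simps)

lemma bq_inv_zero [simp]: "bq_inv 0 = 0"
  by (simp add: vec_eq_iff bq_inv_nth)

lemma bq_inv_one: "bq_inv bq_one = (bq_one :: 'a::field biquat)"
  by (simp add: vec_eq_iff bq_inv_nth bq_eps_def qeps_def bq_one_def)

lemma bq_trd_inv: "bq_trd (bq_inv x) = bq_trd x"
  by (simp add: bq_trd_def bq_inv_def qeps_def)

lemma bq_trd_zero [simp]: "bq_trd 0 = 0"
  by (simp add: bq_trd_def)

lemma bq_trd_add: "bq_trd (x + y) = bq_trd x + bq_trd y"
  by (simp add: bq_trd_def algebra_simps)

lemma bq_trd_scale: "bq_trd (k *s x) = k * bq_trd x"
  by (simp add: bq_trd_def algebra_simps)

(* Coordinate descriptions of Q1 (x) 1, 1 (x) Q2, Q1^0 (x) Q2^0 and of the gamma-skew elements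
   Q1^0 (x) 1 + 1 (x) Q2^0. *)
definition bq_Q1 :: "'a::field biquat set" where
  "bq_Q1 = {x. \<forall>p. snd p \<noteq> Q0 \<longrightarrow> x $ p = 0}"

definition bq_Q2 :: "'a::field biquat set" where
  "bq_Q2 = {x. \<forall>p. fst p \<noteq> Q0 \<longrightarrow> x $ p = 0}"

definition bq_pure_pure :: "'a::field biquat set" where
  "bq_pure_pure = {x. \<forall>p. fst p = Q0 \<or> snd p = Q0 \<longrightarrow> x $ p = 0}"

definition bq_skew :: "'a::field biquat set" where
  "bq_skew = {x. \<forall>p. (fst p = Q0 \<longleftrightarrow> snd p = Q0) \<longrightarrow> x $ p = 0}"

lemma bq_Q1D: "x \<in> bq_Q1 \<Longrightarrow> snd p \<noteq> Q0 \<Longrightarrow> x $ p = 0"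
  unfolding bq_Q1_def by blast

lemma bq_Q2D: "x \<in> bq_Q2 \<Longrightarrow> fst p \<noteq> Q0 \<Longrightarrow> x $ p = 0"
  unfolding bq_Q2_def by blast

lemma bq_pure_pureD: "x \<in> bq_pure_pure \<Longrightarrow> fst p = Q0 \<or> snd p = Q0 \<Longrightarrow> x $ p = 0"
  unfolding bq_pure_pure_def by blast

lemma bq_skewD: "x \<in> bq_skew \<Longrightarrow> (fst p = Q0 \<longleftrightarrow> snd p = Q0) \<Longrightarrow> x $ p = 0"
  unfolding bq_skew_def by blast

lemma bq_pure_pureI:
  assumes char: "(2::'a::field) \<noteq> 0" and "bq_inv u = u" "bq_trd u = 0"
  shows "u \<in> (bq_pure_pure :: 'a biquat set)"
  unfolding bq_pure_pure_def
proof (intro CollectI allI impI)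
  fix p :: "qb \<times> qb"
  assume p: "fst p = Q0 \<or> snd p = Q0"
  show "u $ p = 0"
  proof (cases "p = (Q0, Q0)")
    case True
    have "(4::'a) = 2 * 2" by simp
    with char have "(4::'a) \<noteq> 0" by (simp only: mult_eq_0_iff) simp
    with True assms(3) show ?thesis by (simp add: bq_trd_def)
  next
    case False
    with p have "bq_eps p = (-1::'a)"
      by (cases p) (auto simp: bq_eps_def qeps_def)
    with assms(2) have "u $ p = - u $ p"
      by (metis bq_inv_nth mult_minus1)
    with char show ?thesis by (rule eq_neg_imp_zero)
  qed
qed

lemma bq_skewI:
  assumes char: "(2::'a::field) \<noteq> 0" and "bq_inv x = - x"
  shows "x \<in> (bq_skew :: 'a biquat set)"
  unfolding bq_skew_def
proof (intro CollectI allI impI)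
  fix p :: "qb \<times> qb"
  assume "fst p = Q0 \<longleftrightarrow> snd p = Q0"
  then have "bq_eps p = (1::'a)"
    by (cases p) (auto simp: bq_eps_def qeps_def)
  with assms(2) have "x $ p = - x $ p"
    by (metis bq_inv_nth mult_1 vector_uminus_component)
  with char show "x $ p = 0" by (rule eq_neg_imp_zero)
qed

lemma bq_inv_Q1: "x \<in> bq_Q1 \<Longrightarrow> bq_inv x \<in> bq_Q1"
  by (simp add: bq_Q1_def bq_inv_nth)

lemma bq_inv_Q2: "x \<in> bq_Q2 \<Longrightarrow> bq_inv x \<in> bq_Q2"
  by (simp add: bq_Q2_def bq_inv_nth)

lemma subspace_bq_Q2: "vec.subspace bq_Q2"
  unfolding vec.subspace_def bq_Q2_def by simp

(* The pure quaternion p i + q j + r k of Q1, as an element of D. *)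
definition bq_pure1 :: "'a::field \<Rightarrow> 'a \<Rightarrow> 'a \<Rightarrow> 'a biquat" where
  "bq_pure1 p q r = (\<chi> s. if s = (QI, Q0) then p else if s = (QJ, Q0) then q
                          else if s = (QK, Q0) then r else 0)"

lemma bq_pure1_Q1: "bq_pure1 p q r \<in> bq_Q1"
  by (auto simp: bq_Q1_def bq_pure1_def)

lemma bq_pure1_Q0: "bq_pure1 p q r $ (Q0, Q0) = 0"
  by (simp add: bq_pure1_def)

definition bq_Q2_basis :: "'a::field biquat set" where
  "bq_Q2_basis = range (\<lambda>s. axis (Q0, s) 1)"

lemma bq_Q2_basis_subset: "bq_Q2_basis \<subseteq> bq_Q2"
  by (auto simp: bq_Q2_basis_def bq_Q2_def axis_def)

lemma independent_bq_Q2_basis: "vec.independent bq_Q2_basis"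
  by (rule vec.independent_mono[OF independent_cart_basis]) (auto simp: bq_Q2_basis_def cart_basis_def)

lemma card_bq_Q2_basis: "card (bq_Q2_basis :: 'a::field biquat set) = 4"
proof -
  have "inj (\<lambda>s. axis (Q0, s) (1::'a))"
    by (rule injI) (simp add: axis_eq_axis)
  then have "card (bq_Q2_basis :: 'a biquat set) = card (UNIV :: qb set)"
    unfolding bq_Q2_basis_def by (rule card_image)
  also have "\<dots> = 4"
    by (simp add: UNIV_qb)
  finally show ?thesis .
qed

locale biquaternion =
  fixes a b c d :: "'a::field"
begin

abbreviation bmult :: "'a biquat \<Rightarrow> 'a biquat \<Rightarrow> 'a biquat" (infixl \<open>\<odot>\<close> 70)
  where "x \<odot> y \<equiv> bq_mult a b c d x y"

definition sc :: "qb \<times> qb \<Rightarrow> qb \<times> qb \<Rightarrow> qb \<times> qb \<Rightarrow> 'a" where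
  "sc s t r = qsc a b (fst s) (fst t) (fst r) * qsc c d (snd s) (snd t) (snd r)"

definition sq :: "qb \<times> qb \<Rightarrow> 'a" where
  "sq p = qsq a b (fst p) * qsq c d (snd p)"

lemma bq_mult_nth: "(x \<odot> y) $ r = (\<Sum>s\<in>UNIV. \<Sum>t\<in>UNIV. x $ s * y $ t * sc s t r)"
  by (simp add: bq_mult_def sc_def mult.assoc)

lemma sc_assoc: "(\<Sum>m\<in>UNIV. sc s t m * sc m w r) = (\<Sum>m\<in>UNIV. sc t w m * sc s m r)"
proof -
  have "(\<Sum>m\<in>UNIV. sc s t m * sc m w r) =
      (\<Sum>m1\<in>UNIV. qsc a b (fst s) (fst t) m1 * qsc a b m1 (fst w) (fst r)) *
      (\<Sum>m2\<in>UNIV. qsc c d (snd s) (snd t) m2 * qsc c d m2 (snd w) (snd r))"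
    unfolding sc_def sum_UNIV_prod sum_product by (simp add: mult_ac)
  also have "\<dots> = (\<Sum>m1\<in>UNIV. qsc a b (fst t) (fst w) m1 * qsc a b (fst s) m1 (fst r)) *
      (\<Sum>m2\<in>UNIV. qsc c d (snd t) (snd w) m2 * qsc c d (snd s) m2 (snd r))"
    by (simp only: qsc_assoc)
  also have "\<dots> = (\<Sum>m\<in>UNIV. sc t w m * sc s m r)"
    unfolding sc_def sum_UNIV_prod sum_product by (simp add: mult_ac)
  finally show ?thesis .
qed

lemma bq_mult_assoc: "x \<odot> y \<odot> z = x \<odot> (y \<odot> z)"
proof (rule vec_eq_iff[THEN iffD2], rule allI)
  fix r
  let ?c = "\<lambda>s t w. x $ s * y $ t * z $ w"
  have "(x \<odot> y \<odot> z) $ r =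
      (\<Sum>m\<in>UNIV. \<Sum>w\<in>UNIV. \<Sum>s\<in>UNIV. \<Sum>t\<in>UNIV. ?c s t w * (sc s t m * sc m w r))"
    unfolding bq_mult_nth sum_distrib_right sum_distrib_left by (simp add: mult_ac)
  also have "\<dots> = (\<Sum>s\<in>UNIV. \<Sum>t\<in>UNIV. \<Sum>w\<in>UNIV. \<Sum>m\<in>UNIV. ?c s t w * (sc s t m * sc m w r))"
    by (rule sum_outer4_innermost)
  also have "\<dots> = (\<Sum>s\<in>UNIV. \<Sum>t\<in>UNIV. \<Sum>w\<in>UNIV. \<Sum>m\<in>UNIV. ?c s t w * (sc t w m * sc s m r))"
    by (simp only: sum_distrib_left[symmetric] sc_assoc)
  also have "\<dots> = (\<Sum>s\<in>UNIV. \<Sum>m\<in>UNIV. \<Sum>t\<in>UNIV. \<Sum>w\<in>UNIV. ?c s t w * (sc t w m * sc s m r))"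
    by (intro sum.cong refl sum_outer3_innermost[symmetric])
  also have "\<dots> = (x \<odot> (y \<odot> z)) $ r"
    unfolding bq_mult_nth sum_distrib_right sum_distrib_left by (simp add: mult_ac)
  finally show "(x \<odot> y \<odot> z) $ r = (x \<odot> (y \<odot> z)) $ r" .
qed

lemma sc_anti_involution: "bq_eps r * sc s t r = bq_eps s * bq_eps t * sc t s r"
proof -
  have "bq_eps r * sc s t r =
      (qeps (fst r) * qsc a b (fst s) (fst t) (fst r)) * (qeps (snd r) * qsc c d (snd s) (snd t) (snd r))"
    by (simp add: bq_eps_def sc_def mult_ac)
  also have "\<dots> = (qeps (fst s) * qeps (fst t) * qsc a b (fst t) (fst s) (fst r)) *
      (qeps (snd s) * qeps (snd t) * qsc c d (snd t) (snd s) (snd r))"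
    by (simp only: qsc_anti_involution)
  also have "\<dots> = bq_eps s * bq_eps t * sc t s r"
    by (simp add: bq_eps_def sc_def mult_ac)
  finally show ?thesis .
qed

lemma bq_inv_mult: "bq_inv (x \<odot> y) = bq_inv y \<odot> bq_inv x"
proof (rule vec_eq_iff[THEN iffD2], rule allI)
  fix r
  have "bq_inv (x \<odot> y) $ r = (\<Sum>s\<in>UNIV. \<Sum>t\<in>UNIV. x $ s * y $ t * (bq_eps r * sc s t r))"
    unfolding bq_inv_nth bq_mult_nth sum_distrib_left by (simp add: mult_ac)
  also have "\<dots> = (\<Sum>t\<in>UNIV. \<Sum>s\<in>UNIV. x $ s * y $ t * (bq_eps s * bq_eps t * sc t s r))"
    unfolding sc_anti_involution by (rule sum.swap)
  also have "\<dots> = (bq_inv y \<odot> bq_inv x) $ r"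
    unfolding bq_inv_nth bq_mult_nth by (simp add: mult_ac)
  finally show "bq_inv (x \<odot> y) $ r = (bq_inv y \<odot> bq_inv x) $ r" .
qed

lemma bq_mult_one_left: "bq_one \<odot> x = x"
proof -
  have "(bq_one \<odot> x) $ r = x $ r" for r
    unfolding bq_mult_nth
    by (subst sum_sum_eq_single[where i = "(Q0, Q0)" and j = r])
      (auto simp: bq_one_def sc_def qsc_Q0_left prod_eq_iff)
  then show ?thesis by (simp add: vec_eq_iff)
qed

lemma bq_mult_one_right: "x \<odot> bq_one = x"
proof -
  have "(x \<odot> bq_one) $ r = x $ r" for r
    unfolding bq_mult_nth
    by (subst sum_sum_eq_single[where i = r and j = "(Q0, Q0)"])
      (auto simp: bq_one_def sc_def qsc_Q0_right prod_eq_iff)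
  then show ?thesis by (simp add: vec_eq_iff)
qed

lemma bq_mult_add_left: "(x + y) \<odot> z = x \<odot> z + y \<odot> z"
  by (simp add: vec_eq_iff bq_mult_nth algebra_simps sum.distrib)

lemma bq_mult_add_right: "z \<odot> (x + y) = z \<odot> x + z \<odot> y"
  by (simp add: vec_eq_iff bq_mult_nth algebra_simps sum.distrib)

lemma bq_mult_scale_left: "(k *s x) \<odot> y = k *s (x \<odot> y)"
  by (simp add: vec_eq_iff bq_mult_nth sum_distrib_left mult_ac)

lemma bq_mult_scale_right: "x \<odot> (k *s y) = k *s (x \<odot> y)"
  by (simp add: vec_eq_iff bq_mult_nth sum_distrib_left mult_ac)

lemma bq_mult_neg_left: "(- x) \<odot> y = - (x \<odot> y)"
  by (simp add: vec_eq_iff bq_mult_nth sum_negf)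

lemma bq_mult_neg_right: "x \<odot> (- y) = - (x \<odot> y)"
  by (simp add: vec_eq_iff bq_mult_nth sum_negf)

lemma bq_mult_zero_left: "0 \<odot> y = 0"
  by (simp add: vec_eq_iff bq_mult_nth)

lemma bq_mult_zero_right: "x \<odot> 0 = 0"
  by (simp add: vec_eq_iff bq_mult_nth)

lemma bq_inverse_eq:
  assumes "u \<odot> w = bq_one" "w \<odot> u = bq_one"
  shows "bq_inverse a b c d u = w"
  unfolding bq_inverse_def
proof (rule the_equality)
  fix w' assume "u \<odot> w' = bq_one \<and> w' \<odot> u = bq_one"
  then show "w' = w"
    by (metis assms(1) bq_mult_assoc bq_mult_one_left bq_mult_one_right)
qed (use assms in simp)

lemma bq_i_square: "axis (QI, Q0) 1 \<odot> axis (QI, Q0) 1 = a *s bq_one"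
  unfolding vec_eq_iff bq_mult_nth
  by (subst sum_sum_eq_single[where i = "(QI, Q0)" and j = "(QI, Q0)"])
    (auto simp: axis_def bq_one_def sc_def qsc_def)

lemma sc_coeff_one: "sc s t (Q0, Q0) = (if s = t then sq s else 0)"
  by (auto simp: sc_def sq_def qsc_coeff_one prod_eq_iff)

lemma bq_trd_mult: "bq_trd (x \<odot> y) = 4 * (\<Sum>s\<in>UNIV. x $ s * y $ s * sq s)"
  by (simp add: bq_trd_def bq_mult_nth sc_coeff_one if_distrib cong: if_cong)

lemma bq_trd_mult_commute: "bq_trd (x \<odot> y) = bq_trd (y \<odot> x)"
  by (simp add: bq_trd_mult mult_ac)

lemma bq_trd_rotate: "bq_trd (x \<odot> y \<odot> z) = bq_trd (z \<odot> x \<odot> y)"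
  by (metis bq_mult_assoc bq_trd_mult_commute)

lemma bq_Q1_mult:
  assumes "x \<in> bq_Q1" "y \<in> bq_Q1"
  shows "x \<odot> y \<in> bq_Q1"
proof -
  have "(x \<odot> y) $ r = 0" if r: "snd r \<noteq> Q0" for r
  proof -
    have vanish: "x $ s * y $ t * sc s t r = 0" for s t
    proof (cases "snd s = Q0 \<and> snd t = Q0")
      case True
      with r show ?thesis by (simp add: sc_def qsc_Q0_left)
    next
      case False
      with assms show ?thesis by (auto dest: bq_Q1D)
    qed
    show ?thesis by (simp only: bq_mult_nth vanish sum.neutral_const)
  qed
  then show ?thesis unfolding bq_Q1_def by blast
qed

lemma bq_Q2_mult:
  assumes "x \<in> bq_Q2" "y \<in> bq_Q2"
  shows "x \<odot> y \<in> bq_Q2"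
proof -
  have "(x \<odot> y) $ r = 0" if r: "fst r \<noteq> Q0" for r
  proof -
    have vanish: "x $ s * y $ t * sc s t r = 0" for s t
    proof (cases "fst s = Q0 \<and> fst t = Q0")
      case True
      with r show ?thesis by (simp add: sc_def qsc_Q0_left)
    next
      case False
      with assms show ?thesis by (auto dest: bq_Q2D)
    qed
    show ?thesis by (simp only: bq_mult_nth vanish sum.neutral_const)
  qed
  then show ?thesis unfolding bq_Q2_def by blast
qed

lemma bq_mult_Q1_Q2_nth:
  assumes x: "x \<in> bq_Q1" and y: "y \<in> bq_Q2"
  shows "(x \<odot> y) $ r = x $ (fst r, Q0) * y $ (Q0, snd r)"
    and "(y \<odot> x) $ r = x $ (fst r, Q0) * y $ (Q0, snd r)"
proof -
  have "x $ s * y $ t * sc s t r = 0" if "(s, t) \<noteq> ((fst r, Q0), (Q0, snd r))" for s t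
  proof (cases "snd s = Q0 \<and> fst t = Q0")
    case True
    with that have "fst s \<noteq> fst r \<or> snd t \<noteq> snd r" by (auto simp: prod_eq_iff)
    with True show ?thesis by (auto simp: sc_def qsc_Q0_left qsc_Q0_right)
  next
    case False
    with x y show ?thesis by (auto dest: bq_Q1D bq_Q2D)
  qed
  then show "(x \<odot> y) $ r = x $ (fst r, Q0) * y $ (Q0, snd r)"
    unfolding bq_mult_nth by (subst sum_sum_eq_single) (auto simp: sc_def qsc_Q0_left qsc_Q0_right)
  have "y $ s * x $ t * sc s t r = 0" if "(s, t) \<noteq> ((Q0, snd r), (fst r, Q0))" for s t
  proof (cases "fst s = Q0 \<and> snd t = Q0")
    case True
    with that have "fst t \<noteq> fst r \<or> snd s \<noteq> snd r" by (auto simp: prod_eq_iff)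
    with True show ?thesis by (auto simp: sc_def qsc_Q0_left qsc_Q0_right)
  next
    case False
    with x y show ?thesis by (auto dest: bq_Q1D bq_Q2D)
  qed
  then show "(y \<odot> x) $ r = x $ (fst r, Q0) * y $ (Q0, snd r)"
    unfolding bq_mult_nth by (subst sum_sum_eq_single) (auto simp: sc_def qsc_Q0_left qsc_Q0_right)
qed

lemma bq_Q1_Q2_commute: "x \<in> bq_Q1 \<Longrightarrow> y \<in> bq_Q2 \<Longrightarrow> x \<odot> y = y \<odot> x"
  by (simp add: vec_eq_iff bq_mult_Q1_Q2_nth)

lemma bq_trd_mult_pure_pure:
  assumes "x \<in> bq_Q1 \<union> bq_Q2" "u \<in> bq_pure_pure"
  shows "bq_trd (x \<odot> u) = 0"
proof -
  have vanish: "x $ s * u $ s * sq s = 0" for s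
    using assms by (cases "fst s = Q0 \<or> snd s = Q0") (auto dest: bq_Q1D bq_Q2D bq_pure_pureD)
  show ?thesis by (simp only: bq_trd_mult vanish sum.neutral_const mult_zero_right)
qed

definition bform :: "'a biquat \<Rightarrow> 'a biquat \<Rightarrow> 'a biquat \<Rightarrow> 'a" where
  "bform u x y = bq_trd (x \<odot> u \<odot> bq_inv y)"

lemma bform_commute:
  assumes "bq_inv u = u"
  shows "bform u x y = bform u y x"
proof -
  have "bform u x y = bq_trd (bq_inv (x \<odot> u \<odot> bq_inv y))"
    by (simp add: bform_def bq_trd_inv)
  also have "\<dots> = bform u y x"
    by (simp add: bform_def bq_inv_mult assms bq_mult_assoc)
  finally show ?thesis .
qed

lemma subspace_bform_left: "vec.subspace {x. bform u x y = 0}"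
  by (simp add: vec.subspace_def bform_def bq_mult_add_left bq_mult_scale_left bq_mult_zero_left
      bq_trd_add bq_trd_scale)

lemma subspace_bform_right: "vec.subspace {y. bform u x y = 0}"
  by (simp add: vec.subspace_def bform_def bq_inv_add bq_inv_scale bq_mult_add_right
      bq_mult_scale_right bq_mult_zero_right bq_trd_add bq_trd_scale)

lemma bform_Q1:
  assumes "x \<in> bq_Q1" "y \<in> bq_Q1" "u \<in> bq_pure_pure"
  shows "bform u x y = 0"
proof -
  have "bform u x y = bq_trd (bq_inv y \<odot> x \<odot> u)"
    by (simp add: bform_def bq_trd_rotate)
  also have "\<dots> = 0"
    using assms by (intro bq_trd_mult_pure_pure) (simp_all add: bq_Q1_mult bq_inv_Q1)
  finally show ?thesis .
qed

lemma bform_Q2_twisted: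
  assumes "m \<in> bq_Q2" "n \<in> bq_Q2" "u \<in> bq_pure_pure"
    and anti: "bq_inv \<alpha> \<odot> u = - (u \<odot> \<alpha>)" and square: "\<alpha> \<odot> \<alpha> = e *s bq_one"
  shows "bform u (m \<odot> bq_inv \<alpha>) (n \<odot> bq_inv \<alpha>) = 0"
proof -
  have anti': "bq_inv \<alpha> \<odot> (u \<odot> z) = - (u \<odot> (\<alpha> \<odot> z))" for z
    by (metis anti bq_mult_assoc bq_mult_neg_left)
  have sq': "\<alpha> \<odot> (\<alpha> \<odot> z) = e *s z" for z
    by (metis square bq_mult_assoc bq_mult_scale_left bq_mult_one_left)
  have "bform u (m \<odot> bq_inv \<alpha>) (n \<odot> bq_inv \<alpha>) = - (e * bq_trd (m \<odot> u \<odot> bq_inv n))"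
    by (simp add: bform_def bq_inv_mult bq_mult_assoc anti' sq' bq_mult_neg_right
        bq_mult_scale_right bq_trd_scale bq_trd_def)
  also have "bq_trd (m \<odot> u \<odot> bq_inv n) = bq_trd (bq_inv n \<odot> m \<odot> u)"
    by (rule bq_trd_rotate)
  also have "\<dots> = 0"
    using assms by (intro bq_trd_mult_pure_pure) (simp_all add: bq_Q2_mult bq_inv_Q2)
  finally show ?thesis by simp
qed

(* With l = l1 (x) 1 + 1 (x) l2, the part x l2 n has trace Trd(x) Trd(l2 n) = 0. *)
lemma bq_trd_pure_skew_Q2:
  assumes "x \<in> bq_Q1" "x $ (Q0, Q0) = 0" "l \<in> bq_skew" "n \<in> bq_Q2"
  shows "bq_trd (x \<odot> l \<odot> n) = n $ (Q0, Q0) * bq_trd (x \<odot> l)"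
  using assms(2)
  by (simp add: bq_trd_mult bq_mult_nth sum_UNIV_prod sum_UNIV_qb sc_def qsc_def sq_def
      bq_Q1D[OF assms(1)] bq_Q2D[OF assms(4)] bq_skewD[OF assms(3)] algebra_simps)

lemma bform_Q1_twisted:
  assumes "x \<in> bq_Q1" "x $ (Q0, Q0) = 0" "u \<odot> \<alpha> \<in> bq_skew" "m \<in> bq_Q2"
    and "bq_trd (x \<odot> (u \<odot> \<alpha>)) = 0"
  shows "bform u x (m \<odot> bq_inv \<alpha>) = 0"
proof -
  have "bform u x (m \<odot> bq_inv \<alpha>) = bq_trd (x \<odot> (u \<odot> \<alpha>) \<odot> bq_inv m)"
    by (simp add: bform_def bq_inv_mult bq_mult_assoc)
  also have "\<dots> = 0"
    using bq_trd_pure_skew_Q2[OF assms(1-3) bq_inv_Q2[OF assms(4)]] assms(5) by simp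
  finally show ?thesis .
qed

lemma bq_trd_pure1_mult:
  "bq_trd (bq_pure1 p q r \<odot> l) =
     4 * (p * (a * l $ (QI, Q0)) + q * (b * l $ (QJ, Q0)) + r * (- (a * b) * l $ (QK, Q0)))"
  by (simp add: bq_trd_mult sum_UNIV_prod sum_UNIV_qb bq_pure1_def sq_def algebra_simps)

lemma bq_pure1_mult_nth:
  shows "(bq_pure1 p q r \<odot> bq_pure1 p' q' r') $ (QI, Q0) = b * (r * q' - q * r')"
    and "(bq_pure1 p q r \<odot> bq_pure1 p' q' r') $ (QJ, Q0) = a * (p * r' - r * p')"
    and "(bq_pure1 p q r \<odot> bq_pure1 p' q' r') $ (QK, Q0) = p * q' - q * p'"
  by (simp_all add: bq_mult_nth sum_UNIV_prod sum_UNIV_qb sc_def qsc_def bq_pure1_def algebra_simps)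

lemma bq_pure1_mult_Q2_imp_parallel:
  assumes "a \<noteq> 0" "b \<noteq> 0" "bq_pure1 p q r \<odot> bq_pure1 p' q' r' \<in> bq_Q2"
  shows "p * q' = q * p' \<and> p * r' = r * p' \<and> q * r' = r * q'"
proof -
  have "(bq_pure1 p q r \<odot> bq_pure1 p' q' r') $ (s, Q0) = 0" if "s \<noteq> Q0" for s
    using that by (intro bq_Q2D[OF assms(3)]) simp
  from this[of QI] this[of QJ] this[of QK] assms(1,2) show ?thesis
    by (simp add: bq_pure1_mult_nth mult.commute)
qed

lemma bq_Q1_twisted_mult:
  assumes square: "\<beta> \<odot> \<beta> = e *s bq_one" and "m1 \<in> bq_Q2" "m2 \<in> bq_Q2" "m1 \<odot> \<beta> \<in> bq_Q1"
  shows "m1 \<odot> \<beta> \<odot> (m2 \<odot> \<beta>) \<in> bq_Q2"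
proof -
  have "m1 \<odot> \<beta> \<odot> (m2 \<odot> \<beta>) = m1 \<odot> \<beta> \<odot> m2 \<odot> \<beta>"
    by (simp only: bq_mult_assoc)
  also have "\<dots> = m2 \<odot> m1 \<odot> (\<beta> \<odot> \<beta>)"
    by (simp only: bq_Q1_Q2_commute[OF assms(4,3)]) (simp only: bq_mult_assoc)
  also have "\<dots> = e *s (m2 \<odot> m1)"
    by (simp add: square bq_mult_scale_right bq_mult_one_right)
  finally show ?thesis
    using assms(2,3) by (simp add: bq_Q2_mult vec.subspace_scale[OF subspace_bq_Q2])
qed

lemma exists_pure_Q1_orthogonal_outside:
  assumes "a \<noteq> 0" "b \<noteq> 0" "\<beta> \<odot> \<beta> = e *s bq_one"
  shows "\<exists>x\<in>bq_Q1. x $ (Q0, Q0) = 0 \<and> bq_trd (x \<odot> l) = 0 \<and> x \<notin> (\<lambda>m. m \<odot> \<beta>) ` bq_Q2"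
proof -
  obtain p q r p' q' r' where
    "p * (a * l $ (QI, Q0)) + q * (b * l $ (QJ, Q0)) + r * (- (a * b) * l $ (QK, Q0)) = 0"
    "p' * (a * l $ (QI, Q0)) + q' * (b * l $ (QJ, Q0)) + r' * (- (a * b) * l $ (QK, Q0)) = 0"
    and nonparallel: "\<not> (p * q' = q * p' \<and> p * r' = r * p' \<and> q * r' = r * q')"
    using exists_nonparallel_solutions by blast
  then have orth: "bq_trd (bq_pure1 p q r \<odot> l) = 0" "bq_trd (bq_pure1 p' q' r' \<odot> l) = 0"
    by (simp_all add: bq_trd_pure1_mult)
  have "bq_pure1 p q r \<notin> (\<lambda>m. m \<odot> \<beta>) ` bq_Q2 \<or> bq_pure1 p' q' r' \<notin> (\<lambda>m. m \<odot> \<beta>) ` bq_Q2"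
  proof (rule ccontr)
    assume "\<not> ?thesis"
    then obtain m1 m2 where m: "m1 \<in> bq_Q2" "m2 \<in> bq_Q2"
      and "bq_pure1 p q r = m1 \<odot> \<beta>" "bq_pure1 p' q' r' = m2 \<odot> \<beta>"
      by blast
    then have "bq_pure1 p q r \<odot> bq_pure1 p' q' r' \<in> bq_Q2"
      using bq_Q1_twisted_mult[OF assms(3) m] bq_pure1_Q1[of p q r] by simp
    with assms(1,2) nonparallel show False
      by (blast dest: bq_pure1_mult_Q2_imp_parallel)
  qed
  with orth show ?thesis
    using bq_pure1_Q1 bq_pure1_Q0 by blast
qed

lemma linear_mult_right: "Vector_Spaces.linear (*s) (*s) (\<lambda>m. m \<odot> \<beta>)"
  by (simp add: Vector_Spaces.linear_iff vec.vector_space_axioms bq_mult_add_left bq_mult_scale_left)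

lemma inj_mult_right:
  assumes "e \<noteq> 0" "\<beta> \<odot> \<beta> = e *s bq_one"
  shows "inj (\<lambda>m. m \<odot> \<beta>)"
proof (rule injI)
  fix x y
  assume eq: "x \<odot> \<beta> = y \<odot> \<beta>"
  have "z \<odot> \<beta> \<odot> \<beta> = e *s z" for z
    by (simp add: bq_mult_assoc assms(2) bq_mult_scale_right bq_mult_one_right)
  with eq have "e *s x = e *s y" by metis
  with assms(1) show "x = y" by simp
qed

lemma independent_insert_twisted_basis:
  assumes "e \<noteq> 0" "\<beta> \<odot> \<beta> = e *s bq_one" "x \<notin> (\<lambda>m. m \<odot> \<beta>) ` bq_Q2"
  shows "vec.independent (insert x ((\<lambda>m. m \<odot> \<beta>) ` bq_Q2_basis))"
    and "card (insert x ((\<lambda>m. m \<odot> \<beta>) ` bq_Q2_basis)) = 5"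
proof -
  let ?R = "\<lambda>m. m \<odot> \<beta>"
  have inj: "inj_on ?R X" for X
    using inj_mult_right[OF assms(1,2)] by (rule inj_on_subset) simp
  have "vec.span (?R ` bq_Q2_basis) = ?R ` vec.span bq_Q2_basis"
    by (rule vec.linear_span_image[OF linear_mult_right])
  also have "\<dots> \<subseteq> ?R ` bq_Q2"
    by (intro image_mono vec.span_minimal bq_Q2_basis_subset subspace_bq_Q2)
  finally have x: "x \<notin> vec.span (?R ` bq_Q2_basis)"
    using assms(3) by (rule contra_subsetD)
  show "vec.independent (insert x (?R ` bq_Q2_basis))"
    by (rule vec.independent_insertI[OF x vec.linear_independent_injective_image])
      (rule linear_mult_right, rule independent_bq_Q2_basis, rule inj)
  have "card (?R ` bq_Q2_basis) = 4"
    by (simp add: card_image[OF inj] card_bq_Q2_basis)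
  moreover have "x \<notin> ?R ` bq_Q2_basis"
    by (rule contra_subsetD[OF vec.span_superset x])
  moreover have "finite (?R ` bq_Q2_basis)"
    unfolding bq_Q2_basis_def by (intro finite_imageI) simp
  ultimately show "card (insert x (?R ` bq_Q2_basis)) = 5"
    by simp
qed

lemma bform_vanishes_insert_twisted_Q2:
  assumes u: "u \<in> bq_pure_pure" "bq_inv u = u"
    and \<alpha>: "\<alpha> \<odot> \<alpha> = e *s bq_one" "bq_inv \<alpha> \<odot> u = - (u \<odot> \<alpha>)" "u \<odot> \<alpha> \<in> bq_skew"
    and x: "x \<in> bq_Q1" "x $ (Q0, Q0) = 0" "bq_trd (x \<odot> (u \<odot> \<alpha>)) = 0"
    and yz: "y \<in> insert x ((\<lambda>m. m \<odot> bq_inv \<alpha>) ` bq_Q2)" "z \<in> insert x ((\<lambda>m. m \<odot> bq_inv \<alpha>) ` bq_Q2)"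
  shows "bform u y z = 0"
proof -
  have xx: "bform u x x = 0"
    by (rule bform_Q1[OF x(1) x(1) u(1)])
  have xm: "bform u x (m \<odot> bq_inv \<alpha>) = 0" if "m \<in> bq_Q2" for m
    by (rule bform_Q1_twisted[OF x(1,2) \<alpha>(3) that x(3)])
  have mx: "bform u (m \<odot> bq_inv \<alpha>) x = 0" if "m \<in> bq_Q2" for m
    using xm[OF that] by (simp add: bform_commute[OF u(2)])
  have mn: "bform u (m \<odot> bq_inv \<alpha>) (n \<odot> bq_inv \<alpha>) = 0" if "m \<in> bq_Q2" "n \<in> bq_Q2" for m n
    by (rule bform_Q2_twisted[OF that u(1) \<alpha>(2,1)])
  from yz xx xm mx mn show ?thesis by auto
qed

lemma exists_totally_isotropic_dim5:
  assumes char: "(2::'a) \<noteq> 0" and "a \<noteq> 0" "b \<noteq> 0" "e \<noteq> 0"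
    and u: "bq_inv u = u" "bq_trd u = 0"
    and \<alpha>: "\<alpha> \<odot> \<alpha> = e *s bq_one" "bq_inv \<alpha> \<odot> u = - (u \<odot> \<alpha>)"
  shows "\<exists>W. vec.subspace W \<and> vec.dim W = 5 \<and> (\<forall>w\<in>W. bq_qform a b c d u w = 0)"
proof -
  have u_pure: "u \<in> bq_pure_pure"
    by (rule bq_pure_pureI[OF char u])
  have "bq_inv (u \<odot> \<alpha>) = - (u \<odot> \<alpha>)"
    using \<alpha>(2) by (simp add: bq_inv_mult u(1))
  then have skew: "u \<odot> \<alpha> \<in> bq_skew"
    by (rule bq_skewI[OF char])
  have \<beta>: "bq_inv \<alpha> \<odot> bq_inv \<alpha> = e *s bq_one"
    by (simp add: \<alpha>(1) bq_inv_scale bq_inv_one flip: bq_inv_mult)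
  obtain x where x: "x \<in> bq_Q1" "x $ (Q0, Q0) = 0" "bq_trd (x \<odot> (u \<odot> \<alpha>)) = 0"
    and x_out: "x \<notin> (\<lambda>m. m \<odot> bq_inv \<alpha>) ` bq_Q2"
    using exists_pure_Q1_orthogonal_outside[OF assms(2,3) \<beta>] by blast
  define S where "S = insert x ((\<lambda>m. m \<odot> bq_inv \<alpha>) ` bq_Q2_basis)"
  have S_sub: "S \<subseteq> insert x ((\<lambda>m. m \<odot> bq_inv \<alpha>) ` bq_Q2)"
    unfolding S_def by (intro insert_mono image_mono bq_Q2_basis_subset)
  have "bform u y z = 0" if "y \<in> S" "z \<in> S" for y z
    by (intro bform_vanishes_insert_twisted_Q2[OF u_pure u(1) \<alpha> skew x] subsetD[OF S_sub] that)
  then have "bform u y z = 0" if "y \<in> vec.span S" "z \<in> vec.span S" for y z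
    by (rule span_isotropic[OF subspace_bform_left subspace_bform_right _ that])
  moreover have "vec.dim (vec.span S) = 5"
    using independent_insert_twisted_basis[OF assms(4) \<beta> x_out]
    by (simp add: S_def vec.dim_eq_card_independent)
  ultimately show ?thesis
    by (intro exI[of _ "vec.span S"]) (simp add: bq_qform_def bform_def)
qed

lemma bq_iso_inv_image_i:
  assumes phi: "bq_iso_inv e f g h a b c d (\<lambda>x. w \<odot> bq_inv x \<odot> u) phi"
    and w: "u \<odot> w = bq_one"
  shows "phi (axis (QI, Q0) 1) \<odot> phi (axis (QI, Q0) 1) = e *s bq_one"
    and "bq_inv (phi (axis (QI, Q0) 1)) \<odot> u = - (u \<odot> phi (axis (QI, Q0) 1))"
proof -
  let ?i = "axis (QI, Q0) (1::'a)"
  have scale: "phi (k *s x) = k *s phi x" for k x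
    using phi by (simp add: bq_iso_inv_def Vector_Spaces.linear_iff)
  have "phi ?i \<odot> phi ?i = phi (bq_mult e f g h ?i ?i)"
    using phi by (simp add: bq_iso_inv_def)
  also have "\<dots> = e *s bq_one"
    using phi by (simp add: biquaternion.bq_i_square scale bq_iso_inv_def)
  finally show "phi ?i \<odot> phi ?i = e *s bq_one" .
  have i_conj: "bq_inv ?i = (-1) *s ?i"
    by (simp add: vec_eq_iff bq_inv_nth bq_eps_def qeps_def axis_def)
  have "w \<odot> bq_inv (phi ?i) \<odot> u = phi (bq_inv ?i)"
    using phi by (simp add: bq_iso_inv_def)
  also have "\<dots> = - phi ?i"
    by (simp only: i_conj scale) simp
  finally have "u \<odot> (w \<odot> bq_inv (phi ?i) \<odot> u) = - (u \<odot> phi ?i)"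
    by (simp add: bq_mult_neg_right)
  then show "bq_inv (phi ?i) \<odot> u = - (u \<odot> phi ?i)"
    by (simp add: w bq_mult_one_left flip: bq_mult_assoc)
qed

end

theorem lemma4p3:
  fixes a b c d e f g h :: "'a::field"
    and u :: "'a biquat"
  assumes char: "(2::'a) \<noteq> 0"
    and nz: "a \<noteq> 0" "b \<noteq> 0" "c \<noteq> 0" "d \<noteq> 0" "e \<noteq> 0" "f \<noteq> 0" "g \<noteq> 0" "h \<noteq> 0"
    and u_inv: "bq_invertible a b c d u"
    and u_sym: "bq_inv u = u"
    and u_trd: "bq_trd u = 0"
    and iso: "\<exists>phi. bq_iso_inv e f g h a b c d
                 (\<lambda>x. bq_mult a b c d (bq_mult a b c d (bq_inverse a b c d u) (bq_inv x)) u) phi"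
  shows "\<exists>W. vec.subspace W \<and> vec.dim W = 5 \<and> (\<forall>w\<in>W. bq_qform a b c d u w = 0)"
proof -
  interpret biquaternion a b c d .
  obtain w where w: "u \<odot> w = bq_one" "w \<odot> u = bq_one"
    using u_inv by (auto simp: bq_invertible_def)
  with iso obtain phi where "bq_iso_inv e f g h a b c d (\<lambda>x. w \<odot> bq_inv x \<odot> u) phi"
    by (auto simp: bq_inverse_eq)
  from bq_iso_inv_image_i[OF this w(1)] show ?thesis
    by (rule exists_totally_isotropic_dim5[OF char nz(1,2,5) u_sym u_trd])
qed

end
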